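(* Let $B$ and $R$ be two finite $C_4$-free graphs on the same vertex set $V$. Then $$\omega(G(B,R))\leq \omega(B)+\omega(R)+\frac{1}{2}\min(\omega(B),\omega(R)).$$
   Context: All graphs are simple (no loops or multiple edges). For two graphs $B,R$ on the same vertex set $V$, $G(B,R)$ is the graph with vertex set $V$ in which two vertices are adjacent if they are adjacent in at least one of $B$ and $R$. A clique is a set of pairwise adjacent vertices, and $\omega(G)$ is the maximal size of a clique in $G$. A graph is $C_4$-free if none of its induced subgraphs is isomorphic to the cycle $C_4$ on four vertices. The inequality is between real (rational) numbers. *)

theory Defs
  imports Complex_Main "Graph_Theory.Graph_Theory"
begin

text \<open>
  A finite simple graph is a \<^locale>\<open>pair_graph\<close>: a finite vertex set with a symmetric and
  loop-free set of arcs between its members, so that an undirected edge is a pair of opposite arcs.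
\<close>

definition cycle4 :: "nat pair_pre_digraph" where
  "cycle4 = \<lparr> pverts = {0..<4},
     parcs = {(i, j). i < 4 \<and> j < 4 \<and> (j = (i + 1) mod 4 \<or> i = (j + 1) mod 4)} \<rparr>"

definition C4_free :: "('a, 'b) pre_digraph \<Rightarrow> bool" where
  "C4_free G \<longleftrightarrow> \<not> (\<exists>H. induced_subgraph H G \<and> digraph_iso H (with_proj cycle4))"

definition is_clique :: "('a, 'b) pre_digraph \<Rightarrow> 'a set \<Rightarrow> bool" where
  "is_clique G S \<longleftrightarrow> S \<subseteq> verts G \<and> pairwise (\<lambda>u v. u \<rightarrow>\<^bsub>G\<^esub> v) S"

text \<open>
  Meaningful for a finite vertex set, where the maximum is over a finite set; that set contains
  0, since the empty set is a clique, and the graph without vertices has clique number 0.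
\<close>

definition clique_number :: "('a, 'b) pre_digraph \<Rightarrow> nat" (\<open>\<omega>\<close>) where
  "\<omega> G = Max {card S | S. is_clique G S}"

end

theory Submission
  imports Defs
begin

text \<open>
  Fix a maximum clique \<open>W\<close> of the union. Let \<open>P\<close> join two distinct vertices of \<open>W\<close> that
  are not adjacent in \<open>R\<close>, and let \<open>Q\<close> join two that are not adjacent in \<open>B\<close>. As every pair
  is adjacent in \<open>B\<close> or in \<open>R\<close>, the graphs \<open>P\<close> and \<open>Q\<close> are edge-disjoint. A \<open>B\<close>-clique
  inside \<open>W\<close> is a \<open>Q\<close>-independent set, an \<open>R\<close>-clique is a \<open>P\<close>-independent set, and
  \<open>C\<^sub>4\<close>-freeness of \<open>R\<close> and \<open>B\<close> says that in \<open>P\<close> and in \<open>Q\<close> any two disjoint edges are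
  joined by a third edge of the same graph, since the complement of \<open>C\<^sub>4\<close> consists of two
  disjoint edges. The question becomes how large \<open>W\<close> is compared with its independent sets.

  If \<open>W\<close> splits into a \<open>Q\<close>-independent part \<open>J\<close> and a \<open>P\<close>-independent part, then
  \<open>|W| \<le> \<omega>(B) + \<omega>(R)\<close>. A vertex with two \<open>P\<close>-neighbours that are joined in \<open>Q\<close> has to go
  into \<open>J\<close>, and symmetrically. If no vertex is forced both ways, a splitting exists: any maximal
  \<open>Q\<close>-independent set that avoids the vertices forced out of \<open>J\<close> can serve as \<open>J\<close>
  (\<open>partition_if_no_forced_both_ways\<close>).

  If some vertex is forced both ways, then it lies with its four witnesses on a pentagon whose
  sides are edges of \<open>P\<close> and whose diagonals are edges of \<open>Q\<close>
  (\<open>forced_both_ways_imp_C5\<close>). Such a pentagon determines the structure of all of \<open>W\<close>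
  (\<open>C5_cover\<close>, \<open>C5_indep_union\<close>): \<open>W\<close> consists of a set \<open>X\<close> without \<open>Q\<close>-edges to the
  pentagon, a set \<open>Y\<close> without \<open>P\<close>-edges to it, and five classes
  \<open>A\<^sub>0, \<dots>, A\<^sub>4\<close> of vertices that behave like the corners. The set
  \<open>X \<union> A\<^sub>i \<union> A\<^sub>i\<^sub>+\<^sub>1\<close> is \<open>Q\<close>-independent and \<open>Y \<union> A\<^sub>i \<union> A\<^sub>i\<^sub>+\<^sub>2\<close> is
  \<open>P\<close>-independent. With \<open>s\<close> the total size of the classes, averaging over \<open>i\<close> gives
  \<open>|X| + 2s/5 \<le> \<omega>(B)\<close> and \<open>|Y| + 2s/5 \<le> \<omega>(R)\<close>. Hence
  \<open>|W| \<le> |X| + |Y| + s \<le> \<omega>(B) + \<omega>(R) + s/5\<close>, where \<open>s/5\<close> is at most half of either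
  clique number.
\<close>

section \<open>Two edge-disjoint graphs without induced pairs of disjoint edges\<close>

definition indep_set :: "('a \<Rightarrow> 'a \<Rightarrow> bool) \<Rightarrow> 'a set \<Rightarrow> bool" where
  "indep_set E S \<longleftrightarrow> (\<forall>x\<in>S. \<forall>y\<in>S. \<not> E x y)"

locale disjoint_2K2_free_pair =
  fixes P Q :: "'a \<Rightarrow> 'a \<Rightarrow> bool"
  assumes P_sym: "P x y \<Longrightarrow> P y x"
    and Q_sym: "Q x y \<Longrightarrow> Q y x"
    and P_irrefl: "\<not> P x x"
    and Q_irrefl: "\<not> Q x x"
    and disjoint: "P x y \<Longrightarrow> \<not> Q x y"
    and P_2K2_free: "P x y \<Longrightarrow> P z w \<Longrightarrow> x \<noteq> z \<Longrightarrow> x \<noteq> w \<Longrightarrow> y \<noteq> z \<Longrightarrow> y \<noteq> w \<Longrightarrow>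
        P x z \<or> P x w \<or> P y z \<or> P y w"
    and Q_2K2_free: "Q x y \<Longrightarrow> Q z w \<Longrightarrow> x \<noteq> z \<Longrightarrow> x \<noteq> w \<Longrightarrow> y \<noteq> z \<Longrightarrow> y \<noteq> w \<Longrightarrow>
        Q x z \<or> Q x w \<or> Q y z \<or> Q y w"
begin

text \<open>
  The two graphs play symmetric roles, so each statement about \<open>(P, Q)\<close> also yields its mirror
  image.
\<close>

lemma swapped: "disjoint_2K2_free_pair Q P"
proof
  fix x y
  show "Q x y \<Longrightarrow> \<not> P x y" using disjoint by blast
qed (fact Q_sym P_sym Q_irrefl P_irrefl Q_2K2_free P_2K2_free)+

end

section \<open>Forced vertices\<close>

text \<open>
  If \<open>W\<close> is split into an \<open>F\<close>-independent and an \<open>E\<close>-independent part, then such a \<open>v\<close> must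
  lie in the \<open>F\<close>-independent part: otherwise both \<open>x\<close> and \<open>y\<close> would lie there, although
  they are joined by \<open>F\<close>.
\<close>

definition forced :: "('a \<Rightarrow> 'a \<Rightarrow> bool) \<Rightarrow> ('a \<Rightarrow> 'a \<Rightarrow> bool) \<Rightarrow> 'a \<Rightarrow> bool" where
  "forced E F v \<longleftrightarrow> (\<exists>x y. E v x \<and> E v y \<and> F x y)"

lemma forcedI: "E v x \<Longrightarrow> E v y \<Longrightarrow> F x y \<Longrightarrow> forced E F v"
  unfolding forced_def by blast

text \<open>
  The pentagon \<open>a b c d e\<close> has its sides in \<open>P\<close> and its diagonals in \<open>Q\<close>. The diagonals
  form the pentagon \<open>a c e b d\<close>, so exchanging the colours gives the same kind of configuration.
\<close>

definition two_coloured_C5 ::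
  "('a \<Rightarrow> 'a \<Rightarrow> bool) \<Rightarrow> ('a \<Rightarrow> 'a \<Rightarrow> bool) \<Rightarrow> 'a \<Rightarrow> 'a \<Rightarrow> 'a \<Rightarrow> 'a \<Rightarrow> 'a \<Rightarrow> bool" where
  "two_coloured_C5 P Q a b c d e \<longleftrightarrow>
     P a b \<and> P b c \<and> P c d \<and> P d e \<and> P e a \<and> Q a c \<and> Q c e \<and> Q e b \<and> Q b d \<and> Q d a"

context disjoint_2K2_free_pair
begin

text \<open>
  Let \<open>x y\<close> be the \<open>Q\<close>-edge that forces \<open>u\<close>. It is disjoint from \<open>u v\<close>, and
  \<open>u\<close> has only \<open>P\<close>-edges to it, so some \<open>Q\<close>-edge joins it to \<open>v\<close>. That edge and \<open>v u\<close>
  force \<open>v\<close> in the other direction.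
\<close>

lemma forced_propagates:
  assumes "forced P Q u" "Q u v"
  shows "forced Q P v"
proof -
  obtain x y where xy: "P u x" "P u y" "Q x y"
    using assms(1) unfolding forced_def by blast
  have "\<not> Q u x" "\<not> Q u y" using xy disjoint by blast+
  moreover have "u \<noteq> x" "u \<noteq> y" using xy P_irrefl by blast+
  moreover have "v \<noteq> x" "v \<noteq> y" using calculation assms(2) by blast+
  ultimately have "Q v x \<or> Q v y"
    using Q_2K2_free[OF assms(2) xy(3)] by blast
  then show ?thesis
    using xy assms(2) Q_sym forcedI[of Q v u _ P] by blast
qed

text \<open>
  Let \<open>a b\<close> and \<open>c d\<close> be the two forcing edges. Applying 2K2-freeness to an edge from \<open>v\<close> and
  the forcing edge opposite to it, every one of \<open>a\<close>, \<open>b\<close> has a \<open>P\<close>-neighbour in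
  \<open>{c, d}\<close> and every one of \<open>c\<close>, \<open>d\<close> has a \<open>Q\<close>-neighbour in \<open>{a, b}\<close>. By disjointness
  both graphs are perfect matchings between \<open>{a, b}\<close> and \<open>{c, d}\<close>, which completes the pentagon.
\<close>

lemma forced_both_ways_imp_C5:
  assumes "forced P Q v" "forced Q P v"
  shows "\<exists>a b c d. two_coloured_C5 P Q v a c d b"
proof -
  obtain a b where ab: "P v a" "P v b" "Q a b"
    using assms(1) unfolding forced_def by blast
  obtain c d where cd: "Q v c" "Q v d" "P c d"
    using assms(2) unfolding forced_def by blast
  have nP: "\<not> P v c" "\<not> P v d" and nQ: "\<not> Q v a" "\<not> Q v b"
    using ab cd disjoint by blast+
  have neq: "a \<noteq> c" "a \<noteq> d" "b \<noteq> c" "b \<noteq> d" "v \<noteq> a" "v \<noteq> b" "v \<noteq> c" "v \<noteq> d"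
    using ab cd nP P_irrefl Q_irrefl by metis+
  have "P a c \<or> P a d" using P_2K2_free[OF ab(1) cd(3)] neq nP by blast
  moreover have "P b c \<or> P b d" using P_2K2_free[OF ab(2) cd(3)] neq nP by blast
  moreover have "Q c a \<or> Q c b" using Q_2K2_free[OF cd(1) ab(3)] neq nQ by blast
  moreover have "Q d a \<or> Q d b" using Q_2K2_free[OF cd(2) ab(3)] neq nQ by blast
  ultimately have "(P a c \<and> P b d \<and> Q c b \<and> Q d a) \<or> (P a d \<and> P b c \<and> Q c a \<and> Q d b)"
    using disjoint P_sym by blast
  then have "two_coloured_C5 P Q v a c d b \<or> two_coloured_C5 P Q v a d c b"
    unfolding two_coloured_C5_def using ab cd P_sym Q_sym by blast
  then show ?thesis by blast
qed

text \<open>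
  Take \<open>J\<close> maximal among the \<open>Q\<close>-independent sets that avoid vertices forced out of it. A vertex
  left outside without being forced out has a \<open>Q\<close>-neighbour in \<open>J\<close>. Suppose \<open>x y\<close> is a
  \<open>P\<close>-edge outside \<open>J\<close>. If both ends have \<open>Q\<close>-neighbours \<open>j\<close>, \<open>k\<close> in \<open>J\<close>, then the
  edges \<open>x j\<close> and \<open>y k\<close> must coincide in an end or be joined in \<open>Q\<close>; either way \<open>j\<close> or \<open>k\<close>
  would be forced out of \<open>J\<close>.
\<close>

lemma partition_if_no_forced_both_ways:
  assumes fin: "finite W"
    and ok: "\<And>v. \<not> (forced P Q v \<and> forced Q P v)"
  shows "\<exists>J\<subseteq>W. indep_set Q J \<and> indep_set P (W - J)"
proof -
  define \<J> where "\<J> = {J. J \<subseteq> W \<and> (\<forall>v\<in>J. \<not> forced Q P v) \<and> indep_set Q J}"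
  have "finite \<J>" using fin unfolding \<J>_def by simp
  moreover have "{} \<in> \<J>" unfolding \<J>_def indep_set_def by simp
  ultimately obtain J where J: "J \<in> \<J>" and max: "\<And>K. K \<in> \<J> \<Longrightarrow> J \<subseteq> K \<Longrightarrow> J = K"
    using finite_has_maximal[of \<J>] by blast
  have extend: "\<exists>j\<in>J. Q x j" if x: "x \<in> W - J" "\<not> forced Q P x" for x
  proof (rule ccontr)
    assume "\<not> ?thesis"
    then have "insert x J \<in> \<J>"
      using J x Q_sym Q_irrefl unfolding \<J>_def indep_set_def by blast
    then show False using max[of "insert x J"] x by blast
  qed
  \<comment> \<open>An end that is forced out of \<open>J\<close> would force the other end into it, and the
    \<open>Q\<close>-neighbour in \<open>J\<close> of that other end out of it.\<close>
  have forced_Q: "\<not> forced Q P x" if xy: "x \<in> W - J" "y \<in> W - J" "P x y" for x y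
  proof
    assume "forced Q P x"
    then have "forced P Q y"
      using disjoint_2K2_free_pair.forced_propagates[OF swapped] xy by blast
    moreover obtain j where "j \<in> J" "Q y j" using extend xy ok calculation by blast
    ultimately show False using forced_propagates J unfolding \<J>_def by blast
  qed
  have "\<not> P x y" if xy: "x \<in> W - J" "y \<in> W - J" for x y
  proof
    assume P: "P x y"
    obtain j where j: "j \<in> J" "Q x j" using extend forced_Q P xy by blast
    obtain k where k: "k \<in> J" "Q y k" using extend forced_Q P_sym[OF P] xy by blast
    have no: "\<not> forced Q P j" "\<not> forced Q P k" "\<not> Q j k"
      using J j k unfolding \<J>_def indep_set_def by blast+
    have "\<not> Q x y" using P disjoint by blast
    moreover have "\<not> Q x k" "\<not> Q y j"
      using no forcedI[of Q] Q_sym P P_sym j k by blast+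
    moreover have "x \<noteq> y" "j \<noteq> k" using P P_irrefl j k calculation by blast+
    ultimately show False
      using Q_2K2_free[OF j(2) k(2)] no xy j k Q_sym by blast
  qed
  then have "indep_set P (W - J)" unfolding indep_set_def by blast
  moreover have "J \<subseteq> W" "indep_set Q J" using J unfolding \<J>_def by simp_all
  ultimately show ?thesis by (intro exI[of _ J] conjI)
qed

end

section \<open>The structure around a two-coloured pentagon\<close>

text \<open>
  On a pentagon \<open>a b c d e\<close> these are the vertices that have the same edges to \<open>b\<close>, \<open>c\<close>, \<open>d\<close>,
  \<open>e\<close> as the corner \<open>a\<close>; each of them can replace \<open>a\<close>. Rotating the arguments gives the classes
  of the other corners.
\<close>

definition twins ::
  "('a \<Rightarrow> 'a \<Rightarrow> bool) \<Rightarrow> ('a \<Rightarrow> 'a \<Rightarrow> bool) \<Rightarrow> 'a set \<Rightarrow> 'a \<Rightarrow> 'a \<Rightarrow> 'a \<Rightarrow> 'a \<Rightarrow> 'a set" where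
  "twins P Q W b c d e = {u\<in>W. P u b \<and> P u e \<and> Q u c \<and> Q u d}"

definition nonneighbours ::
  "('a \<Rightarrow> 'a \<Rightarrow> bool) \<Rightarrow> 'a set \<Rightarrow> 'a \<Rightarrow> 'a \<Rightarrow> 'a \<Rightarrow> 'a \<Rightarrow> 'a \<Rightarrow> 'a set" where
  "nonneighbours E W a b c d e = {u\<in>W. \<not> E u a \<and> \<not> E u b \<and> \<not> E u c \<and> \<not> E u d \<and> \<not> E u e}"

lemma two_coloured_C5_rotate:
  "two_coloured_C5 P Q a b c d e \<Longrightarrow> two_coloured_C5 P Q b c d e a"
  unfolding two_coloured_C5_def by blast

context disjoint_2K2_free_pair
begin

lemma two_coloured_C5_swap:
  "two_coloured_C5 P Q a b c d e \<Longrightarrow> two_coloured_C5 Q P a c e b d"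
  unfolding two_coloured_C5_def using P_sym by blast

text \<open>
  The side \<open>c d\<close> is opposite to \<open>a\<close>, and \<open>a\<close> has no \<open>P\<close>-edge to it, so \<open>u\<close> must supply
  the \<open>P\<close>-edge between \<open>u a\<close> and \<open>c d\<close>.
\<close>

lemma C5_neighbour_antipode:
  assumes C: "two_coloured_C5 P Q a b c d e" and u: "P u a"
  shows "P u c \<or> P u d"
proof -
  have no: "\<not> P a c" "\<not> P a d" "P c d" "P d e" "\<not> P c e"
    using C disjoint P_sym Q_sym unfolding two_coloured_C5_def by blast+
  have "a \<noteq> c" "a \<noteq> d" using C Q_irrefl unfolding two_coloured_C5_def by metis+
  moreover have "u \<noteq> c" "u \<noteq> d" using u no P_sym by blast+
  ultimately show ?thesis using P_2K2_free[OF u no(3)] no by blast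
qed

text \<open>
  The previous lemma, for all five corners and both colours, restricts how a vertex
  \<open>u\<close> can be joined to the pentagon. A nonempty \<open>P\<close>-neighbourhood contains both ends
  of a diagonal, a nonempty \<open>Q\<close>-neighbourhood both ends of a side. If both are nonempty, the only way in which they
  can be disjoint is the pattern of a corner.
\<close>

lemma C5_cover:
  assumes C: "two_coloured_C5 P Q a b c d e"
  shows "W \<subseteq> nonneighbours Q W a b c d e \<union> nonneighbours P W a b c d e
    \<union> twins P Q W b c d e \<union> twins P Q W c d e a \<union> twins P Q W d e a b
    \<union> twins P Q W e a b c \<union> twins P Q W a b c d"
proof
  fix u assume u: "u \<in> W"
  note rot = two_coloured_C5_rotate
  note C1 = rot[OF C] note C2 = rot[OF C1] note C3 = rot[OF C2] note C4 = rot[OF C3]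
  note sw = two_coloured_C5_swap
  note PA = C5_neighbour_antipode
  note QA = disjoint_2K2_free_pair.C5_neighbour_antipode[OF swapped]
  have "P u a \<longrightarrow> P u c \<or> P u d" "P u b \<longrightarrow> P u d \<or> P u e" "P u c \<longrightarrow> P u e \<or> P u a"
    "P u d \<longrightarrow> P u a \<or> P u b" "P u e \<longrightarrow> P u b \<or> P u c"
    using PA[OF C] PA[OF C1] PA[OF C2] PA[OF C3] PA[OF C4] by blast+
  moreover have "Q u a \<longrightarrow> Q u e \<or> Q u b" "Q u b \<longrightarrow> Q u a \<or> Q u c" "Q u c \<longrightarrow> Q u b \<or> Q u d"
    "Q u d \<longrightarrow> Q u c \<or> Q u e" "Q u e \<longrightarrow> Q u d \<or> Q u a"
    using QA[OF sw[OF C]] QA[OF sw[OF C1]] QA[OF sw[OF C2]] QA[OF sw[OF C3]] QA[OF sw[OF C4]]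
    by blast+
  moreover have "\<not> (P u x \<and> Q u x)" for x using disjoint by blast
  ultimately show "u \<in> nonneighbours Q W a b c d e \<union> nonneighbours P W a b c d e
    \<union> twins P Q W b c d e \<union> twins P Q W c d e a \<union> twins P Q W d e a b
    \<union> twins P Q W e a b c \<union> twins P Q W a b c d"
    unfolding twins_def nonneighbours_def using u by simp smt
qed

text \<open>
  A \<open>Q\<close>-edge between two such vertices would not be joined in \<open>Q\<close> to the diagonal \<open>a c\<close>.
\<close>

lemma C5_nonneighbours_indep:
  assumes C: "two_coloured_C5 P Q a b c d e"
  shows "indep_set Q (nonneighbours Q W a b c d e)"
  unfolding indep_set_def
proof (intro ballI notI)
  fix x y assume x: "x \<in> nonneighbours Q W a b c d e" and y: "y \<in> nonneighbours Q W a b c d e"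
    and Q: "Q x y"
  have "Q a c" using C unfolding two_coloured_C5_def by blast
  then show False
    using Q_2K2_free[OF Q, of a c] x y Q_sym unfolding nonneighbours_def by blast
qed

text \<open>
  Here and in the next lemma the diagonal \<open>b e\<close> is the edge that could not be joined: the twins
  of \<open>a\<close> have only \<open>P\<close>-edges to its ends.
\<close>

lemma C5_nonneighbours_twins:
  assumes C: "two_coloured_C5 P Q a b c d e"
    and x: "x \<in> nonneighbours Q W a b c d e" and u: "u \<in> twins P Q W b c d e"
  shows "\<not> Q x u"
proof
  assume Q: "Q x u"
  have be: "Q b e" using C Q_sym unfolding two_coloured_C5_def by blast
  have "\<not> Q u b" "\<not> Q u e" "u \<noteq> b" "u \<noteq> e"
    using u disjoint P_irrefl unfolding twins_def by blast+
  then show False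
    using Q_2K2_free[OF Q be] x be Q_sym unfolding nonneighbours_def by blast
qed

lemma C5_twins_indep:
  assumes C: "two_coloured_C5 P Q a b c d e"
  shows "indep_set Q (twins P Q W b c d e)"
  unfolding indep_set_def
proof (intro ballI notI)
  fix x y assume x: "x \<in> twins P Q W b c d e" and y: "y \<in> twins P Q W b c d e"
    and Q: "Q x y"
  have be: "Q b e" using C Q_sym unfolding two_coloured_C5_def by blast
  have "\<not> Q x b" "\<not> Q x e" "\<not> Q y b" "\<not> Q y e" "x \<noteq> b" "x \<noteq> e" "y \<noteq> b" "y \<noteq> e"
    using x y disjoint P_irrefl unfolding twins_def by blast+
  then show False using Q_2K2_free[OF Q be] by blast
qed

text \<open>
  Replace \<open>a\<close> by \<open>u\<close> in the pentagon. As \<open>w\<close> has a \<open>P\<close>-edge to \<open>c\<close> but not to \<open>e\<close>,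
  the remaining corner opposite to \<open>c\<close>, namely \<open>u\<close>, must be a \<open>P\<close>-neighbour of \<open>w\<close>.
\<close>

lemma C5_twins_adjacent:
  assumes C: "two_coloured_C5 P Q a b c d e"
    and u: "u \<in> twins P Q W b c d e" and w: "w \<in> twins P Q W c d e a"
  shows "P u w"
proof -
  have C': "two_coloured_C5 P Q u b c d e"
    using C u P_sym Q_sym unfolding two_coloured_C5_def twins_def by blast
  have "P w c" using w unfolding twins_def by blast
  moreover have "\<not> P w e" using w disjoint unfolding twins_def by blast
  ultimately have "P w u"
    using C5_neighbour_antipode[OF two_coloured_C5_rotate[OF two_coloured_C5_rotate[OF C']]]
    by blast
  then show ?thesis by (rule P_sym)
qed

lemma C5_indep_union:
  assumes C: "two_coloured_C5 P Q a b c d e"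
  shows "indep_set Q (nonneighbours Q W a b c d e \<union> twins P Q W b c d e \<union> twins P Q W c d e a)"
proof -
  have C1: "two_coloured_C5 P Q b c d e a" using C by (rule two_coloured_C5_rotate)
  have "nonneighbours Q W b c d e a = nonneighbours Q W a b c d e"
    unfolding nonneighbours_def by blast
  then have 1: "\<not> Q x u" if "x \<in> nonneighbours Q W a b c d e"
      "u \<in> twins P Q W b c d e \<union> twins P Q W c d e a" for x u
    using that C5_nonneighbours_twins[OF C] C5_nonneighbours_twins[OF C1] by blast
  have 2: "\<not> Q u w" if "u \<in> twins P Q W b c d e" "w \<in> twins P Q W c d e a" for u w
    using C5_twins_adjacent[OF C that] disjoint by blast
  show ?thesis
    using 1 2 C5_nonneighbours_indep[OF C, of W] C5_twins_indep[OF C, of W]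
      C5_twins_indep[OF C1, of W] Q_sym
    unfolding indep_set_def by blast
qed

lemma C5_indep_card:
  assumes C: "two_coloured_C5 P Q a b c d e" and fin: "finite W"
    and bound: "\<forall>S\<subseteq>W. indep_set Q S \<longrightarrow> card S \<le> k"
  shows "card (nonneighbours Q W a b c d e) + card (twins P Q W b c d e)
           + card (twins P Q W c d e a) \<le> k"
proof -
  let ?X = "nonneighbours Q W a b c d e"
  let ?A = "twins P Q W b c d e" let ?B = "twins P Q W c d e a"
  have sub: "?X \<subseteq> W" "?A \<subseteq> W" "?B \<subseteq> W" unfolding nonneighbours_def twins_def by blast+
  then have f: "finite ?X" "finite ?A" "finite ?B" using fin finite_subset by blast+
  have "?A \<inter> ?B = {}" using disjoint unfolding twins_def by blast
  moreover have "?X \<inter> ?A = {}" "?X \<inter> ?B = {}" unfolding nonneighbours_def twins_def by blast+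
  ultimately have "card (?X \<union> ?A \<union> ?B) = card ?X + card ?A + card ?B"
    using f by (simp add: card_Un_disjoint Int_Un_distrib2)
  then show ?thesis
    using bound C5_indep_union[OF C, of W] sub by (metis Un_subset_iff)
qed

text \<open>
  Adding the five rotations of the previous bound counts every class twice.
\<close>

lemma C5_indep_card_total:
  assumes C: "two_coloured_C5 P Q a b c d e" and fin: "finite W"
    and bound: "\<forall>S\<subseteq>W. indep_set Q S \<longrightarrow> card S \<le> k"
  shows "5 * card (nonneighbours Q W a b c d e)
     + 2 * (card (twins P Q W b c d e) + card (twins P Q W c d e a) + card (twins P Q W d e a b)
         + card (twins P Q W e a b c) + card (twins P Q W a b c d)) \<le> 5 * k"
proof -
  note rot = two_coloured_C5_rotate
  note C1 = rot[OF C] note C2 = rot[OF C1] note C3 = rot[OF C2] note C4 = rot[OF C3]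
  have eq: "nonneighbours Q W b c d e a = nonneighbours Q W a b c d e"
    "nonneighbours Q W c d e a b = nonneighbours Q W a b c d e"
    "nonneighbours Q W d e a b c = nonneighbours Q W a b c d e"
    "nonneighbours Q W e a b c d = nonneighbours Q W a b c d e"
    unfolding nonneighbours_def by blast+
  note bd = C5_indep_card[OF _ fin bound]
  show ?thesis
    using bd[OF C] bd[OF C1] bd[OF C2] bd[OF C3] bd[OF C4] unfolding eq by simp
qed

lemma C5_card_bound:
  assumes C: "two_coloured_C5 P Q a b c d e" and fin: "finite W"
    and \<beta>: "\<forall>S\<subseteq>W. indep_set Q S \<longrightarrow> card S \<le> \<beta>"
    and \<rho>: "\<forall>S\<subseteq>W. indep_set P S \<longrightarrow> card S \<le> \<rho>"
  shows "2 * card W \<le> 2 * \<beta> + 2 * \<rho> + min \<beta> \<rho>"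
proof -
  let ?X = "nonneighbours Q W a b c d e" and ?Y = "nonneighbours P W a b c d e"
  let ?A = "twins P Q W b c d e" and ?B = "twins P Q W c d e a" and ?C = "twins P Q W d e a b"
  let ?D = "twins P Q W e a b c" and ?E = "twins P Q W a b c d"
  have sub: "?X \<union> ?Y \<union> ?A \<union> ?B \<union> ?C \<union> ?D \<union> ?E \<subseteq> W"
    unfolding nonneighbours_def twins_def by blast
  have "card W \<le> card (?X \<union> ?Y \<union> ?A \<union> ?B \<union> ?C \<union> ?D \<union> ?E)"
    using C5_cover[OF C, of W] finite_subset[OF sub fin] by (intro card_mono) auto
  also have "\<dots> \<le> card ?X + card ?Y + card ?A + card ?B + card ?C + card ?D + card ?E"
    by (intro order_trans[OF card_Un_le] add_mono order_refl)
  finally have W: "card W \<le> \<dots>" .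
  have Q: "5 * card ?X + 2 * (card ?A + card ?B + card ?C + card ?D + card ?E) \<le> 5 * \<beta>"
    using C5_indep_card_total[OF C fin \<beta>] by blast
  \<comment> \<open>Exchanging the colours permutes the five classes along the diagonals and leaves each of
    them unchanged as a set.\<close>
  have tw: "twins Q P W c e b d = ?A" "twins Q P W e b d a = ?C" "twins Q P W b d a c = ?E"
    "twins Q P W d a c e = ?B" "twins Q P W a c e b = ?D"
    unfolding twins_def by blast+
  have "nonneighbours P W a c e b d = ?Y" unfolding nonneighbours_def by blast
  then have P: "5 * card ?Y + 2 * (card ?A + card ?B + card ?C + card ?D + card ?E) \<le> 5 * \<rho>"
    using disjoint_2K2_free_pair.C5_indep_card_total
      [OF swapped two_coloured_C5_swap[OF C] fin \<rho>] unfolding tw by simp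
  show ?thesis using W P Q by (simp add: min_def)
qed

text \<open>
  The bounds \<open>\<beta>\<close> and \<open>\<rho>\<close> stand for the clique numbers of \<open>B\<close> and \<open>R\<close>. The
  inequality is doubled to stay within the natural numbers.
\<close>

theorem card_bound:
  assumes fin: "finite W"
    and \<beta>: "\<forall>S\<subseteq>W. indep_set Q S \<longrightarrow> card S \<le> \<beta>"
    and \<rho>: "\<forall>S\<subseteq>W. indep_set P S \<longrightarrow> card S \<le> \<rho>"
  shows "2 * card W \<le> 2 * \<beta> + 2 * \<rho> + min \<beta> \<rho>"
proof (cases "\<exists>v. forced P Q v \<and> forced Q P v")
  case True
  then show ?thesis using forced_both_ways_imp_C5 C5_card_bound[OF _ fin \<beta> \<rho>] by blast
next
  case False
  then obtain J where J: "J \<subseteq> W" "indep_set Q J" "indep_set P (W - J)"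
    using partition_if_no_forced_both_ways[OF fin] by blast
  then have "card J \<le> \<beta>" "card (W - J) \<le> \<rho>" using \<beta> \<rho> by blast+
  moreover have "card W = card J + card (W - J)"
    using J fin by (metis card_Diff_subset card_mono finite_subset le_add_diff_inverse)
  ultimately show ?thesis by linarith
qed

end

section \<open>Translation to graphs\<close>

lemma C4_free_imp_diagonal:
  assumes G: "pair_graph G" and free: "C4_free (with_proj G)"
    and arcs: "(a, b) \<in> parcs G" "(b, c) \<in> parcs G" "(c, d) \<in> parcs G" "(d, a) \<in> parcs G"
    and neq: "a \<noteq> c" "b \<noteq> d"
  shows "(a, c) \<in> parcs G \<or> (b, d) \<in> parcs G"
proof (rule ccontr)
  assume no: "\<not> ?thesis"
  interpret pair_graph G by fact
  have revs: "(b, a) \<in> parcs G" "(c, b) \<in> parcs G" "(d, c) \<in> parcs G" "(a, d) \<in> parcs G"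
    using arcs arcs_symmetric by blast+
  have nonarcs: "(a, c) \<notin> parcs G" "(c, a) \<notin> parcs G" "(b, d) \<notin> parcs G" "(d, b) \<notin> parcs G"
    using no arcs_symmetric by blast+
  have loop: "(x, x) \<notin> parcs G" for x using no_loops' by blast
  have V: "a \<in> pverts G" "b \<in> pverts G" "c \<in> pverts G" "d \<in> pverts G"
    using arcs wellformed' by blast+
  have dist: "a \<noteq> b" "b \<noteq> c" "c \<noteq> d" "d \<noteq> a" using arcs loop by blast+
  define H where "H = with_proj \<lparr>pverts = {a, b, c, d},
    parcs = {(a, b), (b, a), (b, c), (c, b), (c, d), (d, c), (d, a), (a, d)}\<rparr>"
  define f where "f x = (if x = a then 0 else if x = b then 1 else if x = c then 2 else 3 :: nat)" for x
  have f: "f a = 0" "f b = 1" "f c = 2" "f d = 3" using dist neq unfolding f_def by auto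
  define h where "h = \<lparr>iso_verts = f, iso_arcs = map_prod f f,
    iso_head = snd :: nat \<times> nat \<Rightarrow> nat, iso_tail = fst\<rparr>"
  have wf: "wf_digraph H" unfolding H_def by unfold_locales auto
  have "induced_subgraph H (with_proj G)"
  proof (intro induced_subgraphI subgraphI)
    show "verts H \<subseteq> verts (with_proj G)" using V by (simp add: H_def)
    show "arcs H \<subseteq> arcs (with_proj G)" using arcs revs by (auto simp: H_def)
    show "compatible (with_proj G) H" unfolding H_def by (rule compatibleI_with_proj)
    show "arcs H = {e \<in> arcs (with_proj G). tail (with_proj G) e \<in> verts H \<and>
        head (with_proj G) e \<in> verts H}"
    proof
      show "arcs H \<subseteq> {e \<in> arcs (with_proj G). tail (with_proj G) e \<in> verts H \<and>
          head (with_proj G) e \<in> verts H}"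
        using arcs revs by (auto simp: H_def)
      show "{e \<in> arcs (with_proj G). tail (with_proj G) e \<in> verts H \<and>
          head (with_proj G) e \<in> verts H} \<subseteq> arcs H"
      proof
        fix e assume "e \<in> {e \<in> arcs (with_proj G). tail (with_proj G) e \<in> verts H \<and>
          head (with_proj G) e \<in> verts H}"
        then obtain x y where e: "e = (x, y)" "(x, y) \<in> parcs G"
          and xy: "x \<in> {a, b, c, d}" "y \<in> {a, b, c, d}"
          by (cases e) (simp add: H_def)
        show "e \<in> arcs H"
          using xy e nonarcs loop unfolding H_def with_proj_simps pair_pre_digraph.simps
          by (elim insertE emptyE) simp_all
      qed
    qed
    show "wf_digraph H" by (rule wf)
    show "wf_digraph (with_proj G)" by unfold_locales
  qed
  moreover have "digraph_iso H (with_proj cycle4)"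
  proof -
    have inj: "inj_on f {a, b, c, d}"
      by (simp add: inj_on_def f)
    have "inj_on (map_prod f f) ({a, b, c, d} \<times> {a, b, c, d})"
      by (rule map_prod_inj_on[OF inj inj])
    then have "inj_on (map_prod f f) (arcs H)" by (rule inj_on_subset) (auto simp: H_def)
    then have "pre_digraph.digraph_isomorphism H h"
      using wf inj unfolding pre_digraph.digraph_isomorphism_def by (auto simp: h_def H_def)
    moreover have "with_proj cycle4 = app_iso h H"
    proof -
      have v: "{0..<4} = {0, 1, 2, 3 :: nat}" by auto
      have "{(i, j). i < 4 \<and> j < 4 \<and> (j = (i + 1) mod 4 \<or> i = (j + 1) mod 4)} =
        {(0, 1), (1, 0), (1, 2), (2, 1), (2, 3), (3, 2), (3, 0), (0, 3 :: nat)}" (is "?L = ?R")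
      proof (intro equalityI subrelI)
        fix i j assume "(i, j) \<in> ?L"
        then have "i \<in> {0, 1, 2, 3}" "j \<in> {0, 1, 2, 3}" "j = (i + 1) mod 4 \<or> i = (j + 1) mod 4"
          unfolding v[symmetric] by simp_all
        then show "(i, j) \<in> ?R" by (elim insertE emptyE) simp_all
      next
        fix i j assume "(i, j) \<in> ?R"
        then show "(i, j) \<in> ?L" by (elim insertE emptyE) simp_all
      qed
      then show ?thesis using v f
        by (simp add: app_iso_def h_def H_def with_proj_def cycle4_def)
    qed
    ultimately show ?thesis unfolding digraph_iso_def by blast
  qed
  ultimately show False using free unfolding C4_free_def by blast
qed

lemma finite_clique_cards:
  assumes "finite (verts G)"
  shows "finite {card S | S. is_clique G S}"
  using assms by (auto simp: is_clique_def intro!: finite_image_set)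

lemma clique_card_le:
  assumes "finite (verts G)" "is_clique G S"
  shows "card S \<le> \<omega> G"
  unfolding clique_number_def using assms finite_clique_cards by (intro Max_ge) auto

lemma clique_number_attained:
  assumes "finite (verts G)"
  obtains S where "is_clique G S" "card S = \<omega> G"
proof -
  have "is_clique G {}" unfolding is_clique_def by simp
  then have "{card S | S. is_clique G S} \<noteq> {}" by blast
  then have "\<omega> G \<in> {card S | S. is_clique G S}"
    unfolding clique_number_def using finite_clique_cards[OF assms] by (intro Max_in) auto
  then show ?thesis using that by auto
qed

text \<open>
  If all four connecting pairs were adjacent, then \<open>x z y w\<close> would be a 4-cycle whose diagonals
  are the two nonadjacent pairs.
\<close>

lemma nonadjacency_2K2_free:
  assumes G: "pair_graph G" "C4_free (with_proj G)"
    and nonadj: "(x, y) \<notin> parcs G" "(z, w) \<notin> parcs G" "x \<noteq> y" "z \<noteq> w"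
  shows "(x, z) \<notin> parcs G \<or> (x, w) \<notin> parcs G \<or> (y, z) \<notin> parcs G \<or> (y, w) \<notin> parcs G"
proof (rule ccontr)
  interpret pair_graph G by fact
  assume "\<not> ?thesis"
  then have "(x, z) \<in> parcs G" "(z, y) \<in> parcs G" "(y, w) \<in> parcs G" "(w, x) \<in> parcs G"
    using arcs_symmetric by blast+
  from C4_free_imp_diagonal[OF G this nonadj(3,4)] nonadj(1,2) show False by simp
qed

theorem theorem1p11:
  fixes V :: "'a set" and B R :: "'a pair_pre_digraph"
  assumes "pair_graph B" and "pair_graph R"
    and "pverts B = V" and "pverts R = V"
    and "C4_free (with_proj B)" and "C4_free (with_proj R)"
  shows "real (\<omega> (Digraph_Component.union (with_proj B) (with_proj R)))
    \<le> real (\<omega> (with_proj B)) + real (\<omega> (with_proj R))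
       + 1 / 2 * min (real (\<omega> (with_proj B))) (real (\<omega> (with_proj R)))"
proof -
  interpret B: pair_graph B by fact
  interpret R: pair_graph R by fact
  let ?U = "Digraph_Component.union (with_proj B) (with_proj R)"
  have V: "finite V" "pverts B = V" "pverts R = V" using assms B.pair_finite_verts by auto
  then have "finite (verts ?U)" unfolding Digraph_Component.union_def by simp
  then obtain W where W: "is_clique ?U W" and card: "card W = \<omega> ?U"
    by (rule clique_number_attained)
  have WV: "W \<subseteq> V" using W V unfolding is_clique_def Digraph_Component.union_def by simp
  then have fin: "finite W" using V finite_subset by blast
  have complete: "(x, y) \<in> parcs B \<or> (x, y) \<in> parcs R" if "x \<in> W" "y \<in> W" "x \<noteq> y" for x y
    using W that unfolding is_clique_def Digraph_Component.union_def
    by (auto simp: pairwise_def arcs_ends_conv)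
  define P where "P x y \<longleftrightarrow> x \<in> W \<and> y \<in> W \<and> x \<noteq> y \<and> (x, y) \<notin> parcs R" for x y
  define Q where "Q x y \<longleftrightarrow> x \<in> W \<and> y \<in> W \<and> x \<noteq> y \<and> (x, y) \<notin> parcs B" for x y
  interpret disjoint_2K2_free_pair P Q
  proof
    fix x y z w
    show "P x y \<Longrightarrow> P y x" "Q x y \<Longrightarrow> Q y x" "\<not> P x x" "\<not> Q x x"
      unfolding P_def Q_def using B.arcs_symmetric R.arcs_symmetric by blast+
    show "P x y \<Longrightarrow> \<not> Q x y" unfolding P_def Q_def using complete by blast
    show "P x y \<Longrightarrow> P z w \<Longrightarrow> x \<noteq> z \<Longrightarrow> x \<noteq> w \<Longrightarrow> y \<noteq> z \<Longrightarrow> y \<noteq> w \<Longrightarrow>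
        P x z \<or> P x w \<or> P y z \<or> P y w"
      unfolding P_def using nonadjacency_2K2_free[OF assms(2,6)] by blast
    show "Q x y \<Longrightarrow> Q z w \<Longrightarrow> x \<noteq> z \<Longrightarrow> x \<noteq> w \<Longrightarrow> y \<noteq> z \<Longrightarrow> y \<noteq> w \<Longrightarrow>
        Q x z \<or> Q x w \<or> Q y z \<or> Q y w"
      unfolding Q_def using nonadjacency_2K2_free[OF assms(1,5)] by blast
  qed
  have "\<forall>S\<subseteq>W. indep_set Q S \<longrightarrow> card S \<le> \<omega> (with_proj B)"
  proof (intro allI impI clique_card_le)
    fix S assume S: "S \<subseteq> W" "indep_set Q S"
    show "finite (verts (with_proj B))" using V by simp
    have "(x, y) \<in> parcs B" if "x \<in> S" "y \<in> S" "x \<noteq> y" for x y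
      using S that unfolding indep_set_def Q_def by blast
    then show "is_clique (with_proj B) S"
      using S WV V unfolding is_clique_def pairwise_def by auto
  qed
  moreover have "\<forall>S\<subseteq>W. indep_set P S \<longrightarrow> card S \<le> \<omega> (with_proj R)"
  proof (intro allI impI clique_card_le)
    fix S assume S: "S \<subseteq> W" "indep_set P S"
    show "finite (verts (with_proj R))" using V by simp
    have "(x, y) \<in> parcs R" if "x \<in> S" "y \<in> S" "x \<noteq> y" for x y
      using S that unfolding indep_set_def P_def by blast
    then show "is_clique (with_proj R) S"
      using S WV V unfolding is_clique_def pairwise_def by auto
  qed
  ultimately have "2 * card W \<le> 2 * \<omega> (with_proj B) + 2 * \<omega> (with_proj R)
      + min (\<omega> (with_proj B)) (\<omega> (with_proj R))"
    by (rule card_bound[OF fin])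
  then show ?thesis unfolding card by linarith
qed

end
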